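(* The Tree Algorithm is a 2-approximation algorithm for HL$_1$ on trees: for every finite tree $T$, the hub labeling $H$ it returns is a feasible hub labeling of $T$ and satisfies $\sum_{u}|H_u|\le 2\cdot OPT$, where $OPT$ is the minimum of $\sum_u |H'_u|$ over all hub labelings $H'$ of $T$.
   Context: For a tree $T=(V,E)$ and $u,v\in V$, let $P_{uv}$ be the vertex set of the unique $u$–$v$ path ($P_{uu}=\{u\}$). A hub labeling of $T$ is a family $\{H_u\}_{u\in V}$ of subsets of $V$ with $H_u\cap H_v\cap P_{uv}\neq\varnothing$ for all $u,v\in V$ (including $u=v$). HL$_1$ is the problem of minimizing $\sum_{u\in V}|H_u|$. A balanced separator vertex of a tree on $n$ vertices is a vertex $r$ such that every connected component of $T-r$ has at most $n/2$ vertices. The Tree Algorithm, on input a tree $T'$: finds a balanced separator vertex $r$ of $T'$; removes $r$ and recursively computes a hub labeling $H'$ of each connected component of $T'-r$ (no recursive call if $T'$ is a single vertex); returns $H_u=H'_u\cup\{r\}$ for every $u\in T'-r$ and $H_r=\{r\}$. *)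

theory Defs
  imports "Graph_Theory.Graph_Theory"
begin

text \<open>
  Finite simple undirected graphs are modelled, as in the Graph Theory library, by the locale
  \<open>graph\<close>: finite symmetric digraphs without loops and parallel arcs, an undirected edge being a
  pair of opposite arcs.  The library predicate \<open>tree\<close> is not usable for them: it forbids all
  directed cycles, so on a symmetric digraph it already excludes a single edge (the closed walk
  \<open>a, b, a\<close> counts as a cycle), and on an oriented graph it admits the transitive triangle.  In a
  simple graph the undirected cycles are exactly the directed cycles of length at least 3.
\<close>

definition undirected_tree :: "('a, 'b) pre_digraph \<Rightarrow> bool" where
  "undirected_tree G \<longleftrightarrow>
     graph G \<and> Digraph_Component.connected G \<and> \<not> (\<exists>p. pre_digraph.cycle G p \<and> 3 \<le> length p)"

definition path_verts :: "('a, 'b) pre_digraph \<Rightarrow> 'a \<Rightarrow> 'a \<Rightarrow> 'a set" where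
  "path_verts G u v =
     set (pre_digraph.awalk_verts G u (THE p. pre_digraph.apath G u p v))"

text \<open>
  A family indexed by the vertices is a total function; its values outside \<^term>\<open>verts G\<close> are
  irrelevant in all the definitions below.
\<close>

definition hub_labeling :: "('a, 'b) pre_digraph \<Rightarrow> ('a \<Rightarrow> 'a set) \<Rightarrow> bool" where
  "hub_labeling G H \<longleftrightarrow>
     (\<forall>u\<in>verts G. H u \<subseteq> verts G) \<and>
     (\<forall>u\<in>verts G. \<forall>v\<in>verts G. H u \<inter> H v \<inter> path_verts G u v \<noteq> {})"

definition hl1_cost :: "('a, 'b) pre_digraph \<Rightarrow> ('a \<Rightarrow> 'a set) \<Rightarrow> nat" where
  "hl1_cost G H = (\<Sum>u\<in>verts G. card (H u))"

definition hl1_opt :: "('a, 'b) pre_digraph \<Rightarrow> nat" where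
  "hl1_opt G = (LEAST k. \<exists>H. hub_labeling G H \<and> hl1_cost G H = k)"

text \<open>
  In a symmetric digraph reachability is symmetric, so the strongly connected components
  (\<open>sccs\<close>: the maximal nonempty strongly connected induced subgraphs) are the connected
  components.
\<close>

definition components_without :: "('a, 'b) pre_digraph \<Rightarrow> 'a \<Rightarrow> ('a, 'b) pre_digraph set" where
  "components_without G r = pre_digraph.sccs (pre_digraph.del_vert G r)"

definition balanced_separator :: "('a, 'b) pre_digraph \<Rightarrow> 'a \<Rightarrow> bool" where
  "balanced_separator G r \<longleftrightarrow>
     r \<in> verts G \<and>
     (\<forall>C\<in>components_without G r. real (card (verts C)) \<le> real (card (verts G)) / 2)"

text \<open>
  \<open>tree_algorithm T H\<close>: some run of the Tree Algorithm on \<open>T\<close> returns \<open>H\<close>.  A relation rather than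
  a function, since a tree may have two balanced separator vertices and the choice is left open.
  \<open>H'\<close> collects the results of the recursive calls, one for each component; a single vertex has no
  components after its removal, hence causes no recursive call.
\<close>

inductive tree_algorithm :: "('a, 'b) pre_digraph \<Rightarrow> ('a \<Rightarrow> 'a set) \<Rightarrow> bool" where
  separate: "tree_algorithm T H"
    if "balanced_separator T r"
      and "\<forall>C\<in>components_without T r. tree_algorithm C (H' C)"
      and "\<forall>C\<in>components_without T r. \<forall>u\<in>verts C. H u = H' C u \<union> {r}"
      and "H r = {r}"

end

theory Submission
  imports Defs
begin

text \<open>
  Let \<open>r\<close> be the separator chosen for a tree \<open>T\<close> on \<open>n\<close> vertices, and call a vertex \<open>u \<noteq> r\<close> local
  for a hub labeling \<open>K\<close> of \<open>T\<close> if \<open>K u\<close> is contained in the component of \<open>T - r\<close> around \<open>u\<close>.  Two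
  vertices of different components share a hub, so they cannot both be local; hence all local
  vertices lie in one component, and there are at most \<open>n/2\<close> of them.  Every other vertex, \<open>r\<close>
  included, has a hub outside its component.  As \<open>K\<close> restricts to a hub labeling of each
  component, \<open>cost T K \<ge> n/2 + (\<Sum>C. cost C (K restricted to C))\<close>, whereas the algorithm pays
  \<open>n + (\<Sum>C. cost of its labeling of C)\<close>; the factor 2 follows by induction.

  The facts on trees all come from one observation: two neighbours of \<open>r\<close> that are connected in
  \<open>T - r\<close> coincide, since otherwise they would close a cycle through \<open>r\<close>.
\<close>

section \<open>Deleting a vertex from a graph\<close>

context graph
begin

lemma del_vert_eq_induce: "del_vert r = G \<restriction> (verts G - {r})"
  by (auto simp: del_vert_def induce_subgraph_def)

lemma induced_subgraph_del_vert: "induced_subgraph (del_vert r) G"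
  unfolding del_vert_eq_induce by (rule induced_induce) auto

lemma graph_induced_subgraph:
  assumes "induced_subgraph H G"
  shows "graph H"
  using digraphI_induced[OF assms] induced_graph_imp_symmetric[OF sym_arcs assms]
  by (rule digraph.graphI)

lemma graph_del_vert: "graph (del_vert r)"
  using induced_subgraph_del_vert by (rule graph_induced_subgraph)

lemma awalk_del_vertI:
  assumes "awalk u p v" "r \<notin> set (awalk_verts u p)"
  shows "pre_digraph.awalk (del_vert r) u p v"
  unfolding del_vert_eq_induce using assms by (intro awalk_induce) auto

lemma apath_obtain_reachable:
  assumes "u \<rightarrow>\<^sup>* v"
  obtains p where "apath u p v"
proof -
  obtain p where p: "awalk u p v" using assms reachable_awalk by blast
  show thesis by (rule that[OF apath_awalk_to_apath[OF p]])
qed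

lemma reachable_del_vertI:
  assumes "awalk u p v" "r \<notin> set (awalk_verts u p)"
  shows "u \<rightarrow>\<^sup>*\<^bsub>del_vert r\<^esub> v"
proof -
  interpret D: graph "del_vert r" by (rule graph_del_vert)
  show ?thesis using D.reachable_awalkI[OF awalk_del_vertI[OF assms]] .
qed

section \<open>Components of a graph minus a vertex, and sums over them\<close>

lemma in_component_iff:
  assumes "C \<in> components_without G r" "u \<in> verts C"
  shows "v \<in> verts C \<longleftrightarrow> u \<rightarrow>\<^sup>*\<^bsub>del_vert r\<^esub> v"
proof -
  interpret D: graph "del_vert r" by (rule graph_del_vert)
  have "verts C \<in> D.sccs_verts"
    using assms(1) by (simp add: components_without_def D.sccs_verts_conv)
  \<comment> \<open>One direction of reachability suffices, since the arcs are symmetric.\<close>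
  with assms(2) show ?thesis
    unfolding D.in_sccs_verts_conv_reachable
    using symmetric_reachable[OF D.sym_arcs] by blast
qed

text \<open>Deleting \<open>r\<close> removes only arcs at \<open>r\<close>, so what is induced in
  \<open>del_vert r\<close> is induced in \<open>G\<close>.\<close>

lemma component_induced_subgraph:
  assumes "C \<in> components_without G r"
  shows "induced_subgraph C G"
proof -
  interpret D: graph "del_vert r" by (rule graph_del_vert)
  have ind: "induced_subgraph C (del_vert r)"
    using assms D.in_sccs_imp_induced by (simp add: components_without_def)
  then have "subgraph C G"
    using subgraph_del_vert subgraph_trans by blast
  moreover have "arcs C = {e \<in> arcs G. tail G e \<in> verts C \<and> head G e \<in> verts C}"
    using ind unfolding induced_subgraph_def subgraph_def by (auto simp: del_vert_simps)
  ultimately show ?thesis by blast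
qed

lemma component_subset:
  assumes "C \<in> components_without G r"
  shows "verts C \<subseteq> verts G - {r}"
proof -
  interpret D: graph "del_vert r" by (rule graph_del_vert)
  have "induced_subgraph C (del_vert r)"
    using assms D.in_sccs_imp_induced by (simp add: components_without_def)
  then show ?thesis
    using subgraph_imp_subverts induced_imp_subgraph by (fastforce simp: del_vert_simps)
qed

lemma component_strongly_connected:
  assumes "C \<in> components_without G r"
  shows "strongly_connected C"
  using assms by (auto simp: components_without_def pre_digraph.sccs_def)

lemma component_nonempty:
  assumes "C \<in> components_without G r"
  shows "verts C \<noteq> {}"
  using component_strongly_connected[OF assms] by (simp add: strongly_connected_def)

lemma components_cover:
  assumes "u \<in> verts G" "u \<noteq> r"
  obtains C where "C \<in> components_without G r" "u \<in> verts C"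
proof -
  interpret D: graph "del_vert r" by (rule graph_del_vert)
  have u: "u \<in> verts (del_vert r)" using assms by (simp add: del_vert_simps)
  show thesis
  proof (rule that)
    show "del_vert r \<restriction> {v. u \<rightarrow>\<^sup>*\<^bsub>del_vert r\<^esub> v} \<in> components_without G r"
      unfolding components_without_def by (rule D.induce_reachable_is_in_sccs[OF u])
  qed (simp add: u)
qed

lemma components_unique:
  assumes "C \<in> components_without G r" "C' \<in> components_without G r"
    and "u \<in> verts C" "u \<in> verts C'"
  shows "C = C'"
proof -
  interpret D: graph "del_vert r" by (rule graph_del_vert)
  show ?thesis
    using assms D.scc_disj[of C C'] by (auto simp: components_without_def)
qed

lemma UN_components: "(\<Union>C\<in>components_without G r. verts C) = verts G - {r}"
proof
  show "(\<Union>C\<in>components_without G r. verts C) \<subseteq> verts G - {r}"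
    using component_subset by blast
  show "verts G - {r} \<subseteq> (\<Union>C\<in>components_without G r. verts C)"
  proof
    fix u assume "u \<in> verts G - {r}"
    then obtain C where "C \<in> components_without G r" "u \<in> verts C"
      using components_cover[of u r] by auto
    then show "u \<in> (\<Union>C\<in>components_without G r. verts C)" by blast
  qed
qed

text \<open>Induced subgraphs are determined by their vertex sets, and \<open>verts G\<close> has
  finitely many subsets.\<close>

lemma finite_components: "finite (components_without G r)"
proof (rule finite_imageD)
  show "finite (verts ` components_without G r)"
    by (rule finite_subset[of _ "Pow (verts G)"]) (use component_subset in fastforce)+
  show "inj_on verts (components_without G r)"
    by (rule inj_onI) (metis component_induced_subgraph induced_eq_verts_imp_eq)
qed

lemma finite_component:
  assumes "C \<in> components_without G r"
  shows "finite (verts C)"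
  using component_subset[OF assms] by (rule finite_subset) simp

lemma sum_components:
  fixes f :: "'a \<Rightarrow> nat"
  assumes "r \<in> verts G"
  shows "(\<Sum>u\<in>verts G. f u) = f r + (\<Sum>C\<in>components_without G r. \<Sum>u\<in>verts C. f u)"
proof -
  have "(\<Sum>C\<in>components_without G r. \<Sum>u\<in>verts C. f u)
      = (\<Sum>u\<in>(\<Union>C\<in>components_without G r. verts C). f u)"
    using finite_components finite_component components_unique
    by (intro sum.UNION_disjoint[symmetric]) blast+
  then show ?thesis
    using assms by (simp add: UN_components sum.remove)
qed

lemma component_card_less:
  assumes "C \<in> components_without G r" "r \<in> verts G"
  shows "card (verts C) < card (verts G)"
  using component_subset[OF assms(1)] assms(2) by (intro psubset_card_mono) auto

end

section \<open>Undirected trees\<close>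

text \<open>The form of \<open>undirected_tree\<close> used below: as arcs are symmetric,
  connectedness amounts to strong connectedness, which speaks of reachability directly.\<close>

locale undirected_tree_graph = graph +
  assumes strongly_connected: "strongly_connected G"
    and cycle_length: "cycle p \<Longrightarrow> length p < 3"

lemma undirected_tree_iff: "undirected_tree G \<longleftrightarrow> undirected_tree_graph G"
proof
  assume u: "undirected_tree G"
  then interpret graph G by (simp add: undirected_tree_def)
  show "undirected_tree_graph G"
    using u symmetric_connected_imp_strongly_connected[OF sym_arcs]
    by unfold_locales (auto simp: undirected_tree_def not_le)
next
  assume "undirected_tree_graph G"
  then interpret undirected_tree_graph G .
  have "Digraph_Component.connected G"
    using strongly_connected reachable_mk_symmetricI
    by (auto simp: strongly_connected_def intro!: connectedI)
  then show "undirected_tree G"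
    using graph_axioms cycle_length by (force simp: undirected_tree_def)
qed

context undirected_tree_graph
begin

text \<open>Cycles of a subgraph are cycles of the whole graph; hence the recursive calls are again
  on trees.\<close>

lemma undirected_tree_component:
  assumes "C \<in> components_without G r"
  shows "undirected_tree C"
proof -
  have ind: "induced_subgraph C G" by (rule component_induced_subgraph[OF assms])
  interpret C: graph C by (rule graph_induced_subgraph[OF ind])
  have "undirected_tree_graph C"
    using component_strongly_connected[OF assms] cycle_length
      subgraph_cycle[OF induced_imp_subgraph[OF ind]]
    by unfold_locales auto
  then show ?thesis by (simp add: undirected_tree_iff)
qed

lemma neighbour_unique:
  assumes "e \<in> arcs G" "tail G e = r" "f \<in> arcs G" "tail G f = r"
    and "head G e \<rightarrow>\<^sup>*\<^bsub>del_vert r\<^esub> head G f"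
  shows "e = f"
proof -
  interpret D: graph "del_vert r" by (rule graph_del_vert)
  obtain q where q: "D.apath (head G e) q (head G f)"
    using D.apath_obtain_reachable[OF assms(5)] .
  have qG: "apath (head G e) q (head G f)"
    using subgraph_apath_imp_apath[OF q subgraph_del_vert] .
  have "set (D.awalk_verts (head G e) q) \<subseteq> verts (del_vert r)"
    using q by (auto simp: D.apath_def)
  then have r: "r \<notin> set (awalk_verts (head G e) q)"
    by (auto simp: del_vert_eq_induce awalk_verts_induce)
  obtain f' where f': "f' \<in> arcs G" "tail G f' = head G f" "head G f' = r"
    using assms(3,4) sym_arcs unfolding symmetric_conv by metis
  have walk: "awalk (head G e) (q @ [f']) r"
    using qG f' awalk_appendI arc_implies_awalk by (metis apath_def)
  have "awalk_verts (head G e) (q @ [f']) = awalk_verts (head G e) q @ [r]"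
    using awalk_verts_append[OF walk] f' by simp
  \<comment> \<open>\<open>f'\<close> is the reverse of \<open>f\<close>. The cycle has length
    \<open>length q + 2\<close>, so the length bound forces \<open>q\<close> to be empty and the two
    heads to agree.\<close>
  then have "cycle (e # q @ [f'])"
    using walk r qG assms(1,2) unfolding cycle_def apath_def
    by (intro exI[of _ r]) (auto simp: awalk_Cons_iff)
  from cycle_length[OF this] have "q = []" by simp
  then have "head G e = head G f" using qG by (simp add: apath_Nil_iff)
  then show ?thesis
    using assms no_multi_arcs by (simp add: arc_to_ends_def)
qed

text \<open>Both paths avoid \<open>u\<close> after their first arc, so the two heads are connected
  in \<open>del_vert u\<close> via \<open>v\<close>; \<open>neighbour_unique\<close> identifies the
  first arcs, induction the rest.\<close>

lemma apath_unique:
  assumes "apath u p v" "apath u q v"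
  shows "p = q"
  using assms
proof (induction p arbitrary: u q)
  case Nil
  then show ?case using apath_nonempty_ends by (auto simp: apath_Nil_iff)
next
  case (Cons e p)
  obtain f q' where q: "q = f # q'"
    using Cons.prems apath_nonempty_ends by (cases q) (auto simp: apath_Nil_iff)
  interpret D: graph "del_vert u" by (rule graph_del_vert)
  have e: "e \<in> arcs G" "tail G e = u" "apath (head G e) p v" "u \<notin> set (awalk_verts (head G e) p)"
    using Cons.prems(1) by (auto simp: apath_Cons_iff)
  have f: "f \<in> arcs G" "tail G f = u" "apath (head G f) q' v" "u \<notin> set (awalk_verts (head G f) q')"
    using Cons.prems(2) by (auto simp: apath_Cons_iff q)
  have "head G e \<rightarrow>\<^sup>*\<^bsub>del_vert u\<^esub> v" "head G f \<rightarrow>\<^sup>*\<^bsub>del_vert u\<^esub> v"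
    using e f reachable_del_vertI by (auto simp: apath_def)
  then have "head G e \<rightarrow>\<^sup>*\<^bsub>del_vert u\<^esub> head G f"
    using symmetric_reachable[OF D.sym_arcs] D.reachable_trans by blast
  then have "e = f" using e f neighbour_unique by blast
  then show ?case using Cons.IH e f q by blast
qed

section \<open>Path vertex sets and components\<close>

lemma path_verts_eq:
  assumes "apath u p v"
  shows "path_verts G u v = set (awalk_verts u p)"
proof -
  have "(THE p. apath u p v) = p" using assms apath_unique by blast
  then show ?thesis by (simp add: path_verts_def)
qed

lemma apath_exists:
  assumes "u \<in> verts G" "v \<in> verts G"
  obtains p where "apath u p v"
proof -
  have "u \<rightarrow>\<^sup>* v" using assms strongly_connected by (simp add: strongly_connected_def)
  then show thesis using that by (rule apath_obtain_reachable)
qed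

text \<open>A path of \<open>C\<close> is a path of \<open>G\<close>, hence by uniqueness the path
  of \<open>G\<close> between its ends.\<close>

lemma path_verts_component:
  assumes C: "C \<in> components_without G r" and "u \<in> verts C" "v \<in> verts C"
  shows "path_verts G u v = path_verts C u v"
    and "path_verts C u v \<subseteq> verts C"
proof -
  interpret C: undirected_tree_graph C
    using undirected_tree_component[OF C] by (simp add: undirected_tree_iff)
  have sub: "subgraph C G"
    by (rule induced_imp_subgraph[OF component_induced_subgraph[OF C]])
  obtain p where p: "C.apath u p v" using C.apath_exists assms by blast
  have "C.awalk_verts = awalk_verts"
    using sub compatible_awalk_verts by (metis subgraphE)
  then show "path_verts G u v = path_verts C u v"
    using path_verts_eq[OF subgraph_apath_imp_apath[OF p sub]] C.path_verts_eq[OF p] by simp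
  show "path_verts C u v \<subseteq> verts C"
    using p unfolding C.path_verts_eq[OF p] C.apath_def by blast
qed

text \<open>A path avoiding \<open>r\<close> survives in \<open>del_vert r\<close>, so its ends
  share a component. The cases \<open>u = r\<close> and \<open>v = r\<close> are included, as no
  component contains \<open>r\<close>.\<close>

lemma separator_in_path_verts:
  assumes "u \<in> verts G" "v \<in> verts G"
    and sep: "\<And>C. C \<in> components_without G r \<Longrightarrow> u \<in> verts C \<Longrightarrow> v \<in> verts C \<Longrightarrow> False"
  shows "r \<in> path_verts G u v"
proof (rule ccontr)
  assume r: "r \<notin> path_verts G u v"
  obtain p where p: "apath u p v" using apath_exists assms by blast
  with r have rp: "r \<notin> set (awalk_verts u p)" by (simp add: path_verts_eq)
  then have "u \<noteq> r" using hd_in_awalk_verts(2)[OF p] by auto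
  then obtain C where C: "C \<in> components_without G r" "u \<in> verts C"
    using components_cover assms(1) by blast
  have "u \<rightarrow>\<^sup>*\<^bsub>del_vert r\<^esub> v" using reachable_del_vertI p rp by (auto simp: apath_def)
  then show False using sep C in_component_iff by blast
qed

section \<open>Existence of a balanced separator vertex\<close>

text \<open>A simple path does not return to \<open>r\<close>, so after its first arc it stays in a
  single component.\<close>

lemma first_arc_into_component:
  assumes C: "C \<in> components_without G r" "x \<in> verts C"
    and p: "apath r p x"
  obtains e p' where "p = e # p'" "e \<in> arcs G" "tail G e = r" "head G e \<in> verts C"
proof -
  have "r \<noteq> x" using component_subset C by blast
  then obtain e p' where pe: "p = e # p'" using p by (cases p) (auto simp: apath_Nil_iff)
  then have e: "e \<in> arcs G" "tail G e = r" "apath (head G e) p' x"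
      "r \<notin> set (awalk_verts (head G e) p')"
    using p by (auto simp: apath_Cons_iff)
  interpret D: graph "del_vert r" by (rule graph_del_vert)
  have "head G e \<rightarrow>\<^sup>*\<^bsub>del_vert r\<^esub> x" using reachable_del_vertI e by (auto simp: apath_def)
  then have "head G e \<in> verts C"
    using C in_component_iff symmetric_reachable[OF D.sym_arcs] by blast
  with pe e that show thesis by blast
qed

text \<open>
  Stepping from \<open>r\<close> towards an oversized component \<open>C\<close> leaves \<open>r\<close> and everything outside \<open>C\<close>
  in components of fewer than \<open>n/2\<close> vertices, while \<open>C\<close> itself loses a vertex.
\<close>

lemma move_separator:
  assumes r: "r \<in> verts G" and C: "C \<in> components_without G r"
    and big: "card (verts G) < 2 * card (verts C)"
  obtains s where "s \<in> verts G"
    and "\<And>D. D \<in> components_without G s \<Longrightarrow> card (verts D) < card (verts C)"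
proof -
  obtain x where x: "x \<in> verts C" using component_nonempty[OF C] by blast
  then have "x \<in> verts G" using component_subset[OF C] by blast
  then obtain p where p: "apath r p x" using apath_exists r by blast
  obtain e where e: "e \<in> arcs G" "tail G e = r" "head G e \<in> verts C"
    using first_arc_into_component[OF C x p] by metis
  let ?s = "head G e"
  have "card (verts D) < card (verts C)" if D: "D \<in> components_without G ?s" for D
  \<comment> \<open>If \<open>D\<close> misses \<open>C\<close>, it has at most n - |C| < |C|
    vertices; if it meets \<open>C\<close>, it turns out to lie in \<open>C\<close> without
    \<open>?s\<close>.\<close>
  proof (cases "verts D \<inter> verts C = {}")
    case True
    then have "verts D \<subseteq> verts G - verts C" using component_subset[OF D] by blast
    then have "card (verts D) \<le> card (verts G - verts C)" by (intro card_mono) auto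
    also have "\<dots> = card (verts G) - card (verts C)"
      using component_subset[OF C] finite_component[OF C] by (intro card_Diff_subset) auto
    finally show ?thesis using big by linarith
  next
    case False
    then obtain y where y: "y \<in> verts D" "y \<in> verts C" by blast
    have sub: "subgraph D G"
      by (rule induced_imp_subgraph[OF component_induced_subgraph[OF D]])
    interpret D: undirected_tree_graph D
      using undirected_tree_component[OF D] by (simp add: undirected_tree_iff)
    \<comment> \<open>Otherwise the path in \<open>D\<close> from \<open>r\<close> to
      \<open>y\<close> enters \<open>C\<close> by an arc that must be \<open>e\<close>, so
      \<open>D\<close> would contain the deleted vertex \<open>?s\<close>.\<close>
    have "r \<notin> verts D"
    proof
      assume "r \<in> verts D"
      then obtain q where q: "D.apath r q y" using D.apath_exists y by blast
      obtain f q' where f: "q = f # q'" "f \<in> arcs G" "tail G f = r" "head G f \<in> verts C"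
        using first_arc_into_component[OF C y(2) subgraph_apath_imp_apath[OF q sub]] .
      have "head D f \<in> verts D" using q f(1) by (simp add: D.apath_Cons_iff)
      then have "head G f \<in> verts D" using sub compatible_head by (metis subgraphE)
      moreover have "f = e"
        using neighbour_unique e f in_component_iff[OF C] by blast
      ultimately show False using component_subset[OF D] by blast
    qed
    \<comment> \<open>As \<open>D\<close> avoids \<open>r\<close>, its connectedness carries over to
      \<open>del_vert r\<close>, which confines it to the component \<open>C\<close>.\<close>
    have sub_r: "subgraph D (del_vert r)"
    proof -
      interpret R: graph "del_vert r" by (rule graph_del_vert)
      show ?thesis
        unfolding subgraph_def
      proof (intro conjI R.wf_digraph_axioms D.wf_digraph_axioms)
        have t: "tail G = tail D" "head G = head D"
          using sub by (auto simp: subgraph_def compatible_def)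
        show "verts D \<subseteq> verts (del_vert r)"
          using \<open>r \<notin> verts D\<close> sub by (auto simp: del_vert_simps)
        show "arcs D \<subseteq> arcs (del_vert r)"
          using \<open>r \<notin> verts D\<close> sub D.wellformed t by (auto simp: del_vert_simps)
        show "compatible (del_vert r) D" by (simp add: compatible_def del_vert_simps t)
      qed
    qed
    have "y \<rightarrow>\<^sup>*\<^bsub>del_vert r\<^esub> z" if "z \<in> verts D" for z
    proof (rule pre_digraph.reachable_mono[OF _ sub_r])
      show "y \<rightarrow>\<^sup>*\<^bsub>D\<^esub> z"
        using D.strongly_connected y(1) that by (simp add: strongly_connected_def)
    qed
    then have "verts D \<subseteq> verts C"
      using in_component_iff[OF C y(2)] by blast
    then have "verts D \<subset> verts C" using e(3) component_subset[OF D] by blast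
    then show ?thesis using finite_component[OF C] by (rule psubset_card_mono[rotated])
  qed
  then show thesis using that e(1) head_in_verts by blast
qed

text \<open>Each move of an unbalanced \<open>r\<close> strictly lowers the bound \<open>k\<close>
  on the component sizes, so the moves end at a balanced vertex.\<close>

lemma balanced_separator_exists: "\<exists>r. balanced_separator G r"
proof -
  have "\<exists>r. balanced_separator G r"
    if "r \<in> verts G" "\<And>C. C \<in> components_without G r \<Longrightarrow> card (verts C) \<le> k" for r k
    using that
  proof (induction k arbitrary: r rule: less_induct)
    case (less k)
    show ?case
    proof (cases "balanced_separator G r")
      case False
      then obtain C where C: "C \<in> components_without G r" "card (verts G) < 2 * card (verts C)"
        using less.prems(1) by (auto simp: balanced_separator_def not_le)
      obtain s where s: "s \<in> verts G"
        "\<And>D. D \<in> components_without G s \<Longrightarrow> card (verts D) < card (verts C)"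
        using move_separator[OF less.prems(1) C] by blast
      \<comment> \<open>Positivity follows from \<open>card (verts G) < 2 * card (verts C)\<close>;
        it makes the truncated \<open>card (verts C) - 1\<close> smaller than
        \<open>k\<close>.\<close>
      have k: "card (verts C) \<le> k" "card (verts C) \<noteq> 0"
        using less.prems(2) C by auto
      show ?thesis
      proof (rule less.IH[of "card (verts C) - 1" s])
        show "card (verts C) - 1 < k" using k by linarith
        show "card (verts D) \<le> card (verts C) - 1" if "D \<in> components_without G s" for D
          using s(2)[OF that] by linarith
      qed fact
    qed blast
  qed
  moreover obtain r where "r \<in> verts G"
    using strongly_connected by (auto simp: strongly_connected_def)
  ultimately show ?thesis
    using component_card_less less_imp_le by metis
qed

section \<open>Hub labelings and the separator\<close>

text \<open>The common hub of \<open>u\<close> and \<open>v\<close> on their path survives the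
  restriction, as that path stays in \<open>C\<close>.\<close>

lemma hub_labeling_component:
  assumes K: "hub_labeling G K" and C: "C \<in> components_without G r"
  shows "hub_labeling C (\<lambda>u. K u \<inter> verts C)"
  unfolding hub_labeling_def
proof (intro conjI ballI)
  fix u v assume uv: "u \<in> verts C" "v \<in> verts C"
  then have "K u \<inter> K v \<inter> path_verts G u v \<noteq> {}"
    using K component_subset[OF C] unfolding hub_labeling_def by blast
  then show "K u \<inter> verts C \<inter> (K v \<inter> verts C) \<inter> path_verts C u v \<noteq> {}"
    using path_verts_component[OF C uv] by blast
qed blast

text \<open>Within a component the recursive labeling supplies the hub; otherwise the path passes
  through \<open>r\<close>, which is in every label.\<close>

lemma hub_labeling_separate:
  assumes "r \<in> verts G"
    and lab: "\<And>C. C \<in> components_without G r \<Longrightarrow> hub_labeling C (H' C)"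
    and H: "\<And>C u. C \<in> components_without G r \<Longrightarrow> u \<in> verts C \<Longrightarrow> H u = H' C u \<union> {r}"
    and Hr: "H r = {r}"
  shows "hub_labeling G H"
  unfolding hub_labeling_def
proof (intro conjI ballI)
  fix u assume u: "u \<in> verts G"
  show "H u \<subseteq> verts G"
  proof (cases "u = r")
    case False
    then obtain C where C: "C \<in> components_without G r" "u \<in> verts C"
      using components_cover u by blast
    then have "H' C u \<subseteq> verts C" using lab by (auto simp: hub_labeling_def)
    then show ?thesis using H[OF C] component_subset[OF C(1)] assms(1) by auto
  qed (simp add: Hr assms(1))
next
  have rH: "r \<in> H u" if u: "u \<in> verts G" for u
  proof (cases "u = r")
    case False
    then obtain C where C: "C \<in> components_without G r" "u \<in> verts C"
      using components_cover u by blast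
    then show ?thesis by (simp add: H[OF C])
  qed (simp add: Hr)
  fix u v assume uv: "u \<in> verts G" "v \<in> verts G"
  show "H u \<inter> H v \<inter> path_verts G u v \<noteq> {}"
  proof (cases "\<exists>C\<in>components_without G r. u \<in> verts C \<and> v \<in> verts C")
    case True
    then obtain C where C: "C \<in> components_without G r" "u \<in> verts C" "v \<in> verts C" by blast
    then have "H' C u \<inter> H' C v \<inter> path_verts C u v \<noteq> {}"
      using lab by (auto simp: hub_labeling_def)
    then show ?thesis
      using H[OF C(1,2)] H[OF C(1,3)] path_verts_component(1)[OF C] by auto
  next
    case False
    then have "r \<in> path_verts G u v" using separator_in_path_verts uv by blast
    then show ?thesis using rH uv by blast
  qed
qed

text \<open>The bound is stated doubled, so that n/2 does not have to be rounded.\<close>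

lemma hl1_cost_lower_bound:
  assumes K: "hub_labeling G K" and r: "balanced_separator G r"
  shows "card (verts G) + 2 * (\<Sum>C\<in>components_without G r. hl1_cost C (\<lambda>u. K u \<inter> verts C))
    \<le> 2 * hl1_cost G K"
proof -
  let ?\<C> = "components_without G r"
  have rG: "r \<in> verts G" using r by (simp add: balanced_separator_def)
  have finK: "finite (K u)" if "u \<in> verts G" for u
    using K that finite_verts by (meson finite_subset hub_labeling_def)
  \<comment> \<open>\<open>B\<close> is the set of local vertices.\<close>
  define B where "B = {u. \<exists>C\<in>?\<C>. u \<in> verts C \<and> K u \<subseteq> verts C}"
  have BG: "B \<subseteq> verts G - {r}" using component_subset unfolding B_def by blast
  have inB: "u \<in> B \<longleftrightarrow> K u \<subseteq> verts C" if "C \<in> ?\<C>" "u \<in> verts C" for u C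
    using that components_unique unfolding B_def by blast
  \<comment> \<open>A common hub of two local vertices lies in both their components, which
    therefore coincide.\<close>
  have same: "v \<in> verts C" if "C \<in> ?\<C>" "u \<in> verts C" "u \<in> B" "v \<in> B" for u v C
  proof -
    obtain C' where C': "C' \<in> ?\<C>" "v \<in> verts C'" "K v \<subseteq> verts C'"
      using \<open>v \<in> B\<close> unfolding B_def by blast
    have "K u \<subseteq> verts C" using inB[OF that(1,2)] that(3) by simp
    moreover have "K u \<inter> K v \<noteq> {}"
      using K that(3,4) BG unfolding hub_labeling_def by blast
    ultimately obtain w where "w \<in> verts C" "w \<in> verts C'" using C'(3) by blast
    then have "C = C'" using components_unique[OF that(1) C'(1)] by blast
    then show ?thesis using C'(2) by simp
  qed
  have cardB: "2 * card B \<le> card (verts G)"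
  proof (cases "B = {}")
    case False
    then obtain u C where C: "C \<in> ?\<C>" "u \<in> verts C" "u \<in> B" unfolding B_def by blast
    then have "card B \<le> card (verts C)"
      using same[OF C] finite_component[OF C(1)] by (intro card_mono) auto
    moreover have "2 * card (verts C) \<le> card (verts G)"
      using r C(1) by (auto simp: balanced_separator_def)
    ultimately show ?thesis by linarith
  qed simp
  \<comment> \<open>The pair of \<open>r\<close> with itself needs a hub too, so \<open>r\<close>
    contributes at least 1.\<close>
  have "K r \<inter> K r \<inter> path_verts G r r \<noteq> {}" using K rG unfolding hub_labeling_def by blast
  then have Kr: "1 \<le> card (K r)"
    using finK[OF rG] by (auto simp: Suc_le_eq card_gt_0_iff)
  \<comment> \<open>A nonlocal vertex loses at least one hub when its label is restricted to its
    component.\<close>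
  have step: "card (K u \<inter> verts C) + of_bool (u \<notin> B) \<le> card (K u)"
    if "C \<in> ?\<C>" "u \<in> verts C" for u C
  proof -
    have fin: "finite (K u)" using finK that component_subset by blast
    show ?thesis
    proof (cases "u \<in> B")
      case True
      then show ?thesis using fin by (auto intro: card_mono)
    next
      case False
      then have "K u \<inter> verts C \<subset> K u" using inB that by blast
      then have "card (K u \<inter> verts C) < card (K u)" by (rule psubset_card_mono[OF fin])
      then show ?thesis using False by simp
    qed
  qed
  \<comment> \<open>The vertices are counted as local or nonlocal; the summand 1 split off below is
    \<open>r\<close>, which is never in \<open>B\<close>.\<close>
  have "card (verts G) = (\<Sum>u\<in>verts G. of_bool (u \<in> B) + of_bool (u \<notin> B))"
    unfolding card_eq_sum by (rule sum.cong) auto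
  also have "\<dots> = card B + (\<Sum>u\<in>verts G. of_bool (u \<notin> B))"
  proof -
    have "verts G \<inter> B = B" using BG by blast
    then have "(\<Sum>u\<in>verts G. of_bool (u \<in> B)) = card B"
      using finite_verts by (simp add: sum_of_bool_eq)
    then show ?thesis by (simp add: sum.distrib)
  qed
  also have "(\<Sum>u\<in>verts G. of_bool (u \<notin> B) :: nat)
      = 1 + (\<Sum>C\<in>?\<C>. \<Sum>u\<in>verts C. of_bool (u \<notin> B))"
    unfolding sum_components[OF rG] using BG by auto
  finally have n: "card (verts G) = card B + (1 + (\<Sum>C\<in>?\<C>. \<Sum>u\<in>verts C. of_bool (u \<notin> B)))" .
  have "(\<Sum>C\<in>?\<C>. hl1_cost C (\<lambda>u. K u \<inter> verts C)) + (\<Sum>C\<in>?\<C>. \<Sum>u\<in>verts C. of_bool (u \<notin> B))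
      \<le> (\<Sum>C\<in>?\<C>. \<Sum>u\<in>verts C. card (K u))"
    unfolding hl1_cost_def sum.distrib[symmetric] by (intro sum_mono step)
  then have "(\<Sum>C\<in>?\<C>. hl1_cost C (\<lambda>u. K u \<inter> verts C))
      + (1 + (\<Sum>C\<in>?\<C>. \<Sum>u\<in>verts C. of_bool (u \<notin> B))) \<le> hl1_cost G K"
    unfolding hl1_cost_def[of G] sum_components[OF rG] using Kr by linarith
  then show ?thesis using n cardB by linarith
qed

text \<open>Each recursive label grows by at most the hub \<open>r\<close>, and \<open>r\<close>
  itself pays 1: at most one extra hub per vertex.\<close>

lemma hl1_cost_separate:
  assumes "r \<in> verts G"
    and H: "\<And>C u. C \<in> components_without G r \<Longrightarrow> u \<in> verts C \<Longrightarrow> H u = H' C u \<union> {r}"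
    and Hr: "H r = {r}"
  shows "hl1_cost G H \<le> card (verts G) + (\<Sum>C\<in>components_without G r. hl1_cost C (H' C))"
proof -
  let ?\<C> = "components_without G r"
  have "hl1_cost G H = 1 + (\<Sum>C\<in>?\<C>. \<Sum>u\<in>verts C. card (H' C u \<union> {r}))"
    unfolding hl1_cost_def sum_components[OF assms(1)] using H Hr by simp
  also have "\<dots> \<le> 1 + (\<Sum>C\<in>?\<C>. \<Sum>u\<in>verts C. card (H' C u) + 1)"
    using card_Un_le[of _ "{r}"] by (intro add_left_mono sum_mono) simp
  also have "\<dots> = (1 + (\<Sum>C\<in>?\<C>. \<Sum>u\<in>verts C. 1)) + (\<Sum>C\<in>?\<C>. hl1_cost C (H' C))"
    by (simp only: sum.distrib hl1_cost_def)
  also have "1 + (\<Sum>C\<in>?\<C>. \<Sum>u\<in>verts C. 1) = card (verts G)"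
    using sum_components[OF assms(1), of "\<lambda>_. 1"] by simp
  finally show ?thesis .
qed

end

section \<open>The Tree Algorithm\<close>

text \<open>Ensures that the claim about all runs is not vacuous. Components are smaller trees, so
  induction on the number of vertices applies.\<close>

lemma tree_algorithm_exists:
  assumes "undirected_tree T"
  shows "\<exists>H. tree_algorithm T H"
  using assms
proof (induction "card (verts T)" arbitrary: T rule: less_induct)
  case less
  interpret undirected_tree_graph T using less.prems by (simp add: undirected_tree_iff)
  obtain r where r: "balanced_separator T r" using balanced_separator_exists by blast
  then have rT: "r \<in> verts T" by (simp add: balanced_separator_def)
  have "\<forall>C\<in>components_without T r. \<exists>H. tree_algorithm C H"
    using less.hyps component_card_less rT undirected_tree_component by blast
  then obtain H' where H': "\<forall>C\<in>components_without T r. tree_algorithm C (H' C)" by metis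
  \<comment> \<open>Components are disjoint, so \<open>comp u\<close> is well defined for every
    vertex other than \<open>r\<close>, and the recursive labelings can be glued.\<close>
  define comp where "comp u = (THE C. C \<in> components_without T r \<and> u \<in> verts C)" for u
  define H where "H u = (if u = r then {r} else H' (comp u) u \<union> {r})" for u
  have "H u = H' C u \<union> {r}" if "C \<in> components_without T r" "u \<in> verts C" for C u
  proof -
    have "comp u = C" unfolding comp_def using that components_unique by blast
    moreover have "u \<noteq> r" using that component_subset by blast
    ultimately show ?thesis by (simp add: H_def)
  qed
  moreover have "H r = {r}" by (simp add: H_def)
  ultimately have "tree_algorithm T H"
    using tree_algorithm.separate[OF r H'] by blast
  then show ?case by blast
qed

text \<open>The comparison is with every labeling \<open>K\<close>, because the induction restricts
  \<open>K\<close> to the components, where the restriction need not be optimal even if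
  \<open>K\<close> is.\<close>

lemma tree_algorithm_approximation:
  assumes "tree_algorithm T H" "undirected_tree T"
  shows "hub_labeling T H \<and> (\<forall>K. hub_labeling T K \<longrightarrow> hl1_cost T H \<le> 2 * hl1_cost T K)"
  using assms
proof (induction rule: tree_algorithm.induct)
  case (separate T r H' H)
  interpret undirected_tree_graph T using separate.prems by (simp add: undirected_tree_iff)
  let ?\<C> = "components_without T r"
  have rT: "r \<in> verts T" using separate.hyps by (simp add: balanced_separator_def)
  have IH: "hub_labeling C (H' C)"
      "hub_labeling C K \<Longrightarrow> hl1_cost C (H' C) \<le> 2 * hl1_cost C K" if "C \<in> ?\<C>" for C K
    using separate.IH that undirected_tree_component by blast+
  have H: "H u = H' C u \<union> {r}" if "C \<in> ?\<C>" "u \<in> verts C" for C u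
    using separate.hyps that by blast
  have Hr: "H r = {r}" using separate.hyps by blast
  have "hl1_cost T H \<le> 2 * hl1_cost T K" if K: "hub_labeling T K" for K
  proof -
    have "hl1_cost T H \<le> card (verts T) + (\<Sum>C\<in>?\<C>. hl1_cost C (H' C))"
      by (rule hl1_cost_separate[where H = H and H' = H', OF rT H Hr])
    also have "\<dots> \<le> card (verts T) + (\<Sum>C\<in>?\<C>. 2 * hl1_cost C (\<lambda>u. K u \<inter> verts C))"
      by (intro add_left_mono sum_mono IH(2) hub_labeling_component[OF K])
    also have "\<dots> \<le> 2 * hl1_cost T K"
      using hl1_cost_lower_bound[OF K] separate.hyps by (simp add: sum_distrib_left)
    finally show ?thesis .
  qed
  then show ?case using hub_labeling_separate[where H = H and H' = H', OF rT IH(1) H Hr] by blast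
qed

theorem mainTheorem2:
  fixes T :: "('a, 'b) pre_digraph"
  assumes "undirected_tree T"
  shows "(\<exists>H. tree_algorithm T H) \<and>
         (\<forall>H. tree_algorithm T H \<longrightarrow> hub_labeling T H \<and> hl1_cost T H \<le> 2 * hl1_opt T)"
proof (intro conjI allI impI)
  show "\<exists>H. tree_algorithm T H" by (rule tree_algorithm_exists[OF assms])
  fix H assume "tree_algorithm T H"
  note approx = tree_algorithm_approximation[OF this assms]
  then show "hub_labeling T H" by blast
  \<comment> \<open>Feasibility of \<open>H\<close> shows that some cost is attainable, so
    \<open>LEAST\<close> is attained by an actual labeling.\<close>
  then have "\<exists>k K. hub_labeling T K \<and> hl1_cost T K = k" by blast
  then have "\<exists>K. hub_labeling T K \<and> hl1_cost T K = hl1_opt T"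
    unfolding hl1_opt_def by (rule LeastI_ex)
  then obtain K where "hub_labeling T K" "hl1_cost T K = hl1_opt T" by blast
  then show "hl1_cost T H \<le> 2 * hl1_opt T" using approx by fastforce
qed

end
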